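(* Each of $A^-,A^+,A_-,A_+$ is diagonalizable with eigenvalues \[ \frac{q^i}{q-1}\qquad(0\le i\le N). \] For each of these four matrices and each $0\le i\le N$, the eigenspace with eigenvalue $q^i/(q-1)$ has dimension $\binom{N}{i}_q$.
   Context: Let $q$ be a prime power, $GF(q)$ the field with $q$ elements, $N\ge 1$ an integer, and $\mathbf V$ an $N$-dimensional vector space over $GF(q)$. Let $X$ be the set of all subspaces of $\mathbf V$, ordered by inclusion (the projective geometry $L_N(q)$). For $y,z\in X$, $y$ covers $z$ means $z\subseteq y$ and $\dim y-\dim z=1$. ${\rm Mat}_X(\mathbb C)$ is the algebra of complex matrices with rows and columns indexed by $X$; it acts on $V=\mathbb C^X$ by left multiplication. $A^*\in{\rm Mat}_X(\mathbb C)$ is the diagonal matrix with $(y,y)$-entry $q^{-\dim y}$. $R,L\in{\rm Mat}_X(\mathbb C)$: $R_{y,z}=1$ if $y$ covers $z$ and $0$ otherwise; $L_{y,z}=1$ if $z$ covers $y$ and $0$ otherwise. Fix a real number $\varphi>0$ and define \[ A^+=\frac{(A^* )^{-1}}{q-1}-R,\quad A^-=\frac{(A^* )^{-1}}{q-1}+(A^* )^{-1}L,\quad A_+=\frac{(A^* )^{-1}}{q-1}+\varphi^{-1}R,\quad A_-=\frac{(A^* )^{-1}}{q-1}-\varphi(A^* )^{-1}L . \] For an integer $n\ge0$ put $[n]_q=\frac{q^n-1}{q-1}$, $[n]_q^!=[n]_q[n-1]_q\cdots[1]_q$ (with $[0]_q^!=1$), and $\binom{n}{i}_q=\frac{[n]_q^!}{[i]_q^![n-i]_q^!}$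 for $0\le i\le n$. *)

theory Defs
  imports
    "Jordan_Normal_Form.Jordan_Normal_Form_Uniqueness"
    "HOL-Library.Cardinality"
begin

section \<open>The projective geometry of a vector space\<close>

text \<open>
  The vector space over \<open>GF(q)\<close> is the whole type \<open>'v\<close> with scalar multiplication
  \<open>scale :: 'f \<Rightarrow> 'v \<Rightarrow> 'v\<close>, in the sense of the locale \<^locale>\<open>vector_space\<close>;
  \<open>'f\<close> is a finite field and \<open>q = CARD('f)\<close>.
\<close>

definition subspaces :: "('f::field \<Rightarrow> 'v::ab_group_add \<Rightarrow> 'v) \<Rightarrow> 'v set set" where
  "subspaces scale = {S. module.subspace scale S}"

definition covers :: "('f::field \<Rightarrow> 'v::ab_group_add \<Rightarrow> 'v) \<Rightarrow> 'v set \<Rightarrow> 'v set \<Rightarrow> bool" where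
  "covers scale y z \<longleftrightarrow>
     z \<subseteq> y \<and> int (vector_space.dim scale y) - int (vector_space.dim scale z) = 1"

section \<open>Matrices indexed by the subspaces\<close>

text \<open>
  The matrix type has rows and columns indexed by initial segments of the naturals, so the
  index set \<open>X\<close> enters through a list \<open>xs\<close> enumerating it without repetition: row (or column)
  \<open>i\<close> belongs to the subspace \<open>xs ! i\<close>.
\<close>

definition indexed_mat :: "'x list \<Rightarrow> ('x \<Rightarrow> 'x \<Rightarrow> complex) \<Rightarrow> complex mat" where
  "indexed_mat xs f = mat (length xs) (length xs) (\<lambda>(i, j). f (xs ! i) (xs ! j))"

definition A_star :: "('f::{field,finite} \<Rightarrow> 'v::ab_group_add \<Rightarrow> 'v) \<Rightarrow> 'v set list \<Rightarrow> complex mat" where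
  "A_star scale xs = indexed_mat xs
     (\<lambda>y z. if y = z then inverse (of_nat CARD('f) ^ vector_space.dim scale y) else 0)"

definition R_mat :: "('f::{field,finite} \<Rightarrow> 'v::ab_group_add \<Rightarrow> 'v) \<Rightarrow> 'v set list \<Rightarrow> complex mat" where
  "R_mat scale xs = indexed_mat xs (\<lambda>y z. if covers scale y z then 1 else 0)"

definition L_mat :: "('f::{field,finite} \<Rightarrow> 'v::ab_group_add \<Rightarrow> 'v) \<Rightarrow> 'v set list \<Rightarrow> complex mat" where
  "L_mat scale xs = indexed_mat xs (\<lambda>y z. if covers scale z y then 1 else 0)"

text \<open>
  \<^const>\<open>mat_inverse\<close> returns \<^const>\<open>None\<close> on singular matrices; \<open>A_star_inv\<close> below shows that
  this does not happen here.
\<close>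

definition A_star_inv :: "('f::{field,finite} \<Rightarrow> 'v::ab_group_add \<Rightarrow> 'v) \<Rightarrow> 'v set list \<Rightarrow> complex mat" where
  "A_star_inv scale xs = the (mat_inverse (A_star scale xs))"

lemma A_star_inv:
  fixes scale :: "'f::{field,finite} \<Rightarrow> 'v::ab_group_add \<Rightarrow> 'v"
  assumes "distinct xs"
  shows "A_star_inv scale xs \<in> carrier_mat (length xs) (length xs)"
    and "A_star scale xs * A_star_inv scale xs = 1\<^sub>m (length xs)"
    and "A_star_inv scale xs * A_star scale xs = 1\<^sub>m (length xs)"
proof -
  let ?n = "length xs"
  let ?d = "\<lambda>i. of_nat CARD('f) ^ vector_space.dim scale (xs ! i) :: complex"
  have A: "A_star scale xs = mat_diag ?n (\<lambda>i. inverse (?d i))"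
    using assms unfolding A_star_def indexed_mat_def mat_diag_def
    by (intro eq_matI) (auto simp: nth_eq_iff_index_eq)
  have c: "A_star scale xs \<in> carrier_mat ?n ?n" unfolding A by simp
  have one: "mat_diag ?n (\<lambda>i. inverse (?d i)) * mat_diag ?n ?d = 1\<^sub>m ?n"
    "mat_diag ?n ?d * mat_diag ?n (\<lambda>i. inverse (?d i)) = 1\<^sub>m ?n"
    by (simp_all add: mat_diag_diag flip: mat_diag_one)
  then have "A_star scale xs \<in> Units (ring_mat TYPE(complex) ?n b)" for b :: unit
    unfolding A Units_def ring_mat_simps by (auto intro!: bexI[of _ "mat_diag ?n ?d"])
  then obtain B where B: "mat_inverse (A_star scale xs) = Some B"
    using mat_inverse(1)[OF c, where b = "()"] by (cases "mat_inverse (A_star scale xs)") auto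
  show "A_star_inv scale xs \<in> carrier_mat ?n ?n"
    "A_star scale xs * A_star_inv scale xs = 1\<^sub>m ?n"
    "A_star_inv scale xs * A_star scale xs = 1\<^sub>m ?n"
    using mat_inverse(2)[OF c B] B by (auto simp: A_star_inv_def)
qed

definition A_sup_plus :: "('f::{field,finite} \<Rightarrow> 'v::ab_group_add \<Rightarrow> 'v) \<Rightarrow> 'v set list \<Rightarrow> complex mat" where
  "A_sup_plus scale xs =
     inverse (of_nat CARD('f) - 1) \<cdot>\<^sub>m A_star_inv scale xs - R_mat scale xs"

definition A_sup_minus :: "('f::{field,finite} \<Rightarrow> 'v::ab_group_add \<Rightarrow> 'v) \<Rightarrow> 'v set list \<Rightarrow> complex mat" where
  "A_sup_minus scale xs =
     inverse (of_nat CARD('f) - 1) \<cdot>\<^sub>m A_star_inv scale xs + A_star_inv scale xs * L_mat scale xs"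

definition A_sub_plus ::
  "('f::{field,finite} \<Rightarrow> 'v::ab_group_add \<Rightarrow> 'v) \<Rightarrow> 'v set list \<Rightarrow> real \<Rightarrow> complex mat" where
  "A_sub_plus scale xs \<phi> =
     inverse (of_nat CARD('f) - 1) \<cdot>\<^sub>m A_star_inv scale xs
       + of_real (inverse \<phi>) \<cdot>\<^sub>m R_mat scale xs"

definition A_sub_minus ::
  "('f::{field,finite} \<Rightarrow> 'v::ab_group_add \<Rightarrow> 'v) \<Rightarrow> 'v set list \<Rightarrow> real \<Rightarrow> complex mat" where
  "A_sub_minus scale xs \<phi> =
     inverse (of_nat CARD('f) - 1) \<cdot>\<^sub>m A_star_inv scale xs
       - of_real \<phi> \<cdot>\<^sub>m (A_star_inv scale xs * L_mat scale xs)"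

section \<open>Diagonalizability and eigenspaces\<close>

definition diagonalizable :: "complex mat \<Rightarrow> bool" where
  "diagonalizable A \<longleftrightarrow> (\<exists>D. diagonal_mat D \<and> similar_mat A D)"

definition eigenspace :: "complex mat \<Rightarrow> complex \<Rightarrow> complex vec set" where
  "eigenspace A \<theta> = {v \<in> carrier_vec (dim_row A). A *\<^sub>v v = \<theta> \<cdot>\<^sub>v v}"

definition eigenspace_dim :: "complex mat \<Rightarrow> complex \<Rightarrow> nat" where
  "eigenspace_dim A \<theta> = vectorspace.dim class_ring
     (module_vec TYPE(complex) (dim_row A)\<lparr>carrier := eigenspace A \<theta>\<rparr>)"

section \<open>Gaussian binomial coefficients\<close>

definition q_int :: "nat \<Rightarrow> nat \<Rightarrow> real" where
  "q_int q n = (real q ^ n - 1) / (real q - 1)"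

definition q_fact :: "nat \<Rightarrow> nat \<Rightarrow> real" where
  "q_fact q n = (\<Prod>k\<in>{1..n}. q_int q k)"

text \<open>Only meaningful for \<open>i \<le> n\<close>.\<close>

definition q_binomial :: "nat \<Rightarrow> nat \<Rightarrow> nat \<Rightarrow> real" where
  "q_binomial q n i = q_fact q n / (q_fact q i * q_fact q (n - i))"

end

theory Submission
  imports Defs
begin

text \<open>
  Each of the four matrices is triangular with respect to the grading of the subspaces by their
  dimension, and its diagonal entries \<open>q ^ dim y / (q - 1)\<close> take distinct values at distinct
  dimensions. Solving recursively along the grading for an eigenvector with leading term at \<open>y\<close>,
  for each \<open>y\<close>, yields a unitriangular matrix that conjugates the given matrix to its diagonal.
  The multiplicity of \<open>q ^ i / (q - 1)\<close> is thus the number of \<open>i\<close>-dimensional subspaces, which is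
  found by counting linearly independent \<open>i\<close>-tuples.
\<close>

section \<open>Diagonalizing a matrix that is triangular for a grading\<close>

text \<open>Diagonal entries may coincide within one grade: \<open>tri\<close> forbids nonzero
  off-diagonal entries between indices of equal grade, so solving for an eigenvector only divides by
  differences of diagonal entries at distinct grades, which \<open>diag\<close> makes
  nonzero.\<close>

lemma similar_mat_diag_of_graded:
  fixes A :: "'a::field mat" and f :: "nat \<Rightarrow> nat"
  assumes A: "A \<in> carrier_mat n n"
    and tri: "\<And>i j. i < n \<Longrightarrow> j < n \<Longrightarrow> i \<noteq> j \<Longrightarrow> A $$ (i, j) \<noteq> 0 \<Longrightarrow> f j < f i"
    and diag: "\<And>i j. i < n \<Longrightarrow> j < n \<Longrightarrow> f j < f i \<Longrightarrow> A $$ (i, i) \<noteq> A $$ (j, j)"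
  shows "similar_mat A (mat_diag n (\<lambda>i. A $$ (i, i)))"
proof -
  \<comment> \<open>Row \<open>i\<close> of the equation \<open>A u = A $$ (z, z) u\<close> is
    solved for \<open>u i\<close>, using only values \<open>u w\<close> with
    \<open>f w < f i\<close>. The normalization is 1 at \<open>z\<close> and 0 at every other index
    of grade at most \<open>f z\<close>.\<close>
  define F where "F z u i = (if i = z then 1 else if f i \<le> f z then 0
    else (\<Sum>w | w < n \<and> f w < f i. A $$ (i, w) * u w) / (A $$ (z, z) - A $$ (i, i)))" for z u i
  define u where "u z = wfrec (measure f) (F z)" for z
  \<comment> \<open>The cut in the well-founded recursion is harmless because the sum in
    \<open>F\<close> only reads values at strictly smaller grade.\<close>
  have u: "u z i = F z (u z) i" for z i
    unfolding u_def
    by (subst wfrec[OF wf_measure]) (auto simp: F_def cut_apply intro!: sum.cong)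
  have u1: "u z z = 1" for z by (subst u) (simp add: F_def)
  have u0: "u z i = 0" if "f i \<le> f z" "i \<noteq> z" for z i
    using that by (subst u) (simp add: F_def)
  define U where "U = mat n n (\<lambda>(i, z). u z i)"
  have U: "U \<in> carrier_mat n n" by (simp add: U_def)
  have eig: "(\<Sum>w<n. A $$ (i, w) * u z w) = u z i * A $$ (z, z)" if i: "i < n" and z: "z < n" for i z
  proof -
    let ?s = "\<Sum>w | w < n \<and> f w < f i. A $$ (i, w) * u z w"
    have "(\<Sum>w<n. A $$ (i, w) * u z w) = A $$ (i, i) * u z i + (\<Sum>w\<in>{..<n}-{i}. A $$ (i, w) * u z w)"
      using i by (subst sum.remove[of _ i]) auto
    also have "(\<Sum>w\<in>{..<n}-{i}. A $$ (i, w) * u z w) = ?s"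
      using tri[OF i] by (intro sum.mono_neutral_right) auto
    finally have *: "(\<Sum>w<n. A $$ (i, w) * u z w) = A $$ (i, i) * u z i + ?s" .
    show ?thesis
    proof (cases "f i \<le> f z")
      case True
      then have "u z w = 0" if "f w < f i" for w using that by (intro u0) auto
      then have "?s = 0" by simp
      then show ?thesis using * True u0[of i z] by (cases "i = z") auto
    next
      case False
      then have "u z i = ?s / (A $$ (z, z) - A $$ (i, i))" by (subst u) (auto simp: F_def)
      moreover have "A $$ (z, z) - A $$ (i, i) \<noteq> 0" using diag[OF i z] False by auto
      ultimately have "u z i * (A $$ (z, z) - A $$ (i, i)) = ?s" by simp
      then show ?thesis using * by (simp add: algebra_simps)
    qed
  qed
  have AU: "A * U = U * mat_diag n (\<lambda>i. A $$ (i, i))"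
    unfolding mat_diag_mult_right[OF U]
    using A eig by (intro eq_matI) (auto simp: U_def scalar_prod_def atLeast0LessThan)
  \<comment> \<open>\<open>U\<close> is unitriangular for the grading but not for the order of the
    indices, so instead of computing the determinant, a nonzero kernel vector \<open>v\<close> is
    evaluated at a nonzero coordinate \<open>i\<close> of least grade: there
    \<open>U *\<^sub>v v\<close> has the entry \<open>v $ i\<close>.\<close>
  have "det U \<noteq> 0"
  proof
    assume "det U = 0"
    then obtain v where v: "v \<in> carrier_vec n" "v \<noteq> 0\<^sub>v n" "U *\<^sub>v v = 0\<^sub>v n"
      using det_0_iff_vec_prod_zero_field[OF U] by auto
    then have "\<exists>i. i < n \<and> v $ i \<noteq> 0" by (metis carrier_vecD eq_vecI index_zero_vec)
    then obtain i where i: "i < n" "v $ i \<noteq> 0"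
      and min: "\<And>j. j < n \<Longrightarrow> v $ j \<noteq> 0 \<Longrightarrow> f i \<le> f j"
      using ex_has_least_nat[of "\<lambda>i. i < n \<and> v $ i \<noteq> 0" _ f] by blast
    have "0 = (U *\<^sub>v v) $ i" using v i by simp
    also have "\<dots> = (\<Sum>w<n. u w i * v $ w)"
      using v(1) i by (simp add: U_def scalar_prod_def atLeast0LessThan)
    also have "\<dots> = u i i * v $ i + (\<Sum>w\<in>{..<n}-{i}. u w i * v $ w)"
      using i by (subst sum.remove[of _ i]) auto
    also have "(\<Sum>w\<in>{..<n}-{i}. u w i * v $ w) = 0"
      using min u0[of i] by (intro sum.neutral ballI) (metis Diff_iff insertI1 lessThan_iff mult_zero_left mult_zero_right)
    finally show False using i u1 by simp
  qed
  then have "U \<in> Units (ring_mat TYPE('a) n ())" by (rule det_non_zero_imp_unit[OF U])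
  then obtain P where P: "P \<in> carrier_mat n n" "U * P = 1\<^sub>m n" "P * U = 1\<^sub>m n"
    by (auto simp: Units_def ring_mat_simps)
  have "A = A * (U * P)" using A by (simp add: P(2))
  also have "\<dots> = U * mat_diag n (\<lambda>i. A $$ (i, i)) * P"
    unfolding AU[symmetric] by (rule assoc_mult_mat[OF A U P(1), symmetric])
  finally have eq: "A = U * mat_diag n (\<lambda>i. A $$ (i, i)) * P" .
  show ?thesis by (rule similar_matI[OF _ P(2) P(3) eq]) (use A U P(1) in simp)
qed

section \<open>Eigenspaces and eigenvalues of diagonalizable matrices\<close>

text \<open>Viewing a diagonal matrix as a Jordan matrix with blocks of size 1 gives access to the
  dimension formula for generalized eigenspaces of Jordan matrices.\<close>

lemma mat_diag_eq_jordan_matrix: "mat_diag n d = jordan_matrix (map (\<lambda>i. (1, d i)) [0..<n])"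
proof (induction n arbitrary: d)
  case 0
  then show ?case by (intro eq_matI) (auto simp: jordan_matrix_def mat_diag_def)
next
  case (Suc n)
  \<comment> \<open>The index 0 is split off in front, since Jordan matrices unfold from the head of
    the block list; \<open>d\<close> is therefore arbitrary in the induction and gets
    shifted.\<close>
  have "[0..<Suc n] = 0 # map Suc [0..<n]" by (simp add: upt_conv_Cons map_Suc_upt del: upt_Suc)
  then have "jordan_matrix (map (\<lambda>i. (1, d i)) [0..<Suc n])
      = four_block_mat (jordan_block 1 (d 0)) (0\<^sub>m 1 n) (0\<^sub>m n 1) (mat_diag n (\<lambda>i. d (Suc i)))"
    unfolding Suc.IH by (simp add: jordan_matrix_Cons comp_def sum_list_triv)
  also have "\<dots> = mat_diag (Suc n) d"
    by (intro eq_matI) (auto simp: mat_diag_def jordan_block_def four_block_mat_def Let_def)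
  finally show ?case ..
qed

text \<open>The eigenspace is the kernel of the characteristic matrix, that is, the generalized
  eigenspace of order 1. Its dimension is invariant under similarity, and for Jordan blocks of size
  1 it counts the blocks with eigenvalue \<open>\<theta>\<close>.\<close>

lemma eigenspace_dim_similar_mat_diag:
  assumes "similar_mat A (mat_diag n d)"
  shows "eigenspace_dim A \<theta> = card {i. i < n \<and> d i = \<theta>}"
proof -
  have A: "A \<in> carrier_mat n n"
    using similar_matD[OF assms] by (metis carrier_matD(1) insert_subset mat_diag_dim)
  have C: "char_matrix A \<theta> \<in> carrier_mat n n" using A by simp
  have "eigenspace A \<theta> = mat_kernel (char_matrix A \<theta>)"
  proof -
    have "A *\<^sub>v v = \<theta> \<cdot>\<^sub>v v \<longleftrightarrow> char_matrix A \<theta> *\<^sub>v v = 0\<^sub>v n" if v: "v \<in> carrier_vec n" for v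
    proof -
      have "char_matrix A \<theta> *\<^sub>v v = A *\<^sub>v v + (- \<theta>) \<cdot>\<^sub>v v"
        unfolding char_matrix_def using A v
        by (subst add_mult_distrib_mat_vec[of _ n n]) auto
      then show ?thesis using A v by (auto simp: vec_eq_iff eq_neg_iff_add_eq_0 algebra_simps)
    qed
    then show ?thesis using A C by (auto simp: eigenspace_def mat_kernel[OF C])
  qed
  moreover have "dim_row A = n" using A by simp
  ultimately have "eigenspace_dim A \<theta> = kernel_dim (char_matrix A \<theta>)"
    using C by (simp add: eigenspace_dim_def kernel_dim_def)
  also have "\<dots> = dim_gen_eigenspace A \<theta> 1"
    using C by (simp add: dim_gen_eigenspace_def)
  also have "\<dots> = dim_gen_eigenspace (jordan_matrix (map (\<lambda>i. (1, d i)) [0..<n])) \<theta> 1"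
    by (simp only: dim_gen_eigenspace_similar[OF assms] mat_diag_eq_jordan_matrix)
  also have "\<dots> = length (filter (\<lambda>i. d i = \<theta>) [0..<n])"
    unfolding dim_gen_eigenspace_jordan_matrix
    by (induction n) auto
  also have "\<dots> = card {i. i < n \<and> d i = \<theta>}"
    by (subst length_filter_conv_card) (auto intro: arg_cong[where f = card])
  finally show ?thesis .
qed

text \<open>Similar matrices share their characteristic polynomial, which for the diagonal matrix is
  the product of the linear factors with roots \<open>d i\<close>.\<close>

lemma eigenvalue_similar_mat_diag:
  fixes A :: "'a::field mat"
  assumes "similar_mat A (mat_diag n d)"
  shows "eigenvalue A \<theta> \<longleftrightarrow> (\<exists>i<n. d i = \<theta>)"
proof -
  have A: "A \<in> carrier_mat n n"
    using similar_matD[OF assms] by (metis carrier_matD(1) insert_subset mat_diag_dim)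
  have "char_poly A = char_poly (mat_diag n d)" by (rule char_poly_similar[OF assms])
  also have "\<dots> = (\<Prod>a\<leftarrow>diag_mat (mat_diag n d). [:- a, 1:])"
    by (rule char_poly_upper_triangular[of _ n]) (auto simp: mat_diag_def)
  finally show ?thesis
    by (auto simp: eigenvalue_root_char_poly[OF A] poly_prod_list prod_list_zero_iff diag_mat_def mat_diag_def)
qed

section \<open>Counting subspaces over a finite field\<close>

context vector_space
begin

text \<open>Adjoining \<open>b\<close> to an independent set multiplies the size of the span by the
  size of the field, because every vector of the new span is uniquely \<open>scale c b + x\<close>
  with \<open>x\<close> in the old one.\<close>

lemma card_span_independent:
  assumes "finite (UNIV :: 'a set)" "finite B" "independent B"
  shows "finite (span B) \<and> card (span B) = CARD('a) ^ card B"
  using assms(2,3)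
proof (induction B)
  case empty
  then show ?case by simp
next
  case (insert b B)
  then have indep: "independent B" and b: "b \<notin> span B"
    by (auto simp: independent_insert)
  have "bij_betw (\<lambda>(c, x). scale c b + x) ((UNIV :: 'a set) \<times> span B) (span (insert b B))"
  proof (intro bij_betwI')
    fix p p' :: "'a \<times> 'b" assume p: "p \<in> UNIV \<times> span B" "p' \<in> UNIV \<times> span B"
    obtain c x c' x' where [simp]: "p = (c, x)" "p' = (c', x')" by (cases p, cases p')
    \<comment> \<open>Two different coefficients would put a nonzero multiple of \<open>b\<close>,
      hence \<open>b\<close> itself, into \<open>span B\<close>.\<close>
    have "c = c'" if "scale c b + x = scale c' b + x'"
    proof (rule ccontr)
      assume c: "c \<noteq> c'"
      have "scale (c - c') b = x' - x" using that by (simp add: scale_left_diff_distrib algebra_simps)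
      then have "scale (c - c') b \<in> span B" using p by (auto intro: span_diff)
      then show False using span_scale[of "scale (c - c') b" B "inverse (c - c')"] c b by simp
    qed
    then show "(case p of (c, x) \<Rightarrow> scale c b + x) = (case p' of (c, x) \<Rightarrow> scale c b + x) \<longleftrightarrow> p = p'"
      by auto
  next
    fix p :: "'a \<times> 'b" assume "p \<in> UNIV \<times> span B"
    then show "(case p of (c, x) \<Rightarrow> scale c b + x) \<in> span (insert b B)"
      by (auto simp: span_breakdown_eq intro!: exI[of _ "fst p"])
  next
    fix y assume "y \<in> span (insert b B)"
    then obtain k where "y - scale k b \<in> span B" by (auto simp: span_breakdown_eq)
    then show "\<exists>p\<in>(UNIV :: 'a set) \<times> span B. y = (case p of (c, x) \<Rightarrow> scale c b + x)"
      by (intro bexI[of _ "(k, y - scale k b)"]) auto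
  qed
  moreover have "finite (UNIV \<times> span B :: ('a \<times> 'b) set)"
    "card (UNIV \<times> span B :: ('a \<times> 'b) set) = CARD('a) ^ card (insert b B)"
    using insert.IH[OF indep] insert.hyps assms(1) by (simp_all add: card_cartesian_product)
  ultimately show ?case by (metis bij_betw_finite bij_betw_same_card)
qed

text \<open>Ordered tuples are used because they can be counted one entry at a time. Distinctness is
  a separate condition, since \<open>set l\<close> forgets repetitions.\<close>

definition independent_tuples :: "nat \<Rightarrow> 'b set \<Rightarrow> 'b list set" where
  "independent_tuples k S = {l. length l = k \<and> distinct l \<and> set l \<subseteq> S \<and> independent (set l)}"

end

context finite_dimensional_vector_space
begin

lemma card_subspace:
  assumes "finite (UNIV :: 'a set)" "subspace S"
  shows "finite S" "card S = CARD('a) ^ dim S"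
proof -
  obtain B where B: "B \<subseteq> S" "independent B" "S \<subseteq> span B" "card B = dim S"
    by (rule basis_exists)
  then have "S = span B" using assms(2) span_minimal by blast
  with card_span_independent[OF assms(1) finiteI_independent B(2)] B
  show "finite S" "card S = CARD('a) ^ dim S" by auto
qed

text \<open>A tuple of length \<open>k\<close> extends by exactly the vectors of \<open>S\<close>
  outside its span, and the span has \<open>CARD('a) ^ k\<close> elements. For \<open>k\<close>
  above \<open>dim S\<close> the factor at \<open>j = dim S\<close> is 0, matching the absence of
  such tuples.\<close>

lemma card_independent_tuples:
  assumes fin: "finite (UNIV :: 'a set)" and S: "subspace S"
  shows "finite (independent_tuples k S) \<and>
    card (independent_tuples k S) = (\<Prod>j<k. CARD('a) ^ dim S - CARD('a) ^ j)"
proof (induction k)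
  case 0
  have "independent_tuples 0 S = {[]}" by (auto simp: independent_tuples_def independent_empty)
  then show ?case by simp
next
  case (Suc k)
  \<comment> \<open>The new vector goes to the front of the list. The sum is dependent because the
    span to be avoided varies with \<open>l\<close>, although its size does not.\<close>
  have eq: "independent_tuples (Suc k) S
    = (\<lambda>(l, x). x # l) ` (SIGMA l:independent_tuples k S. S - span (set l))" (is "_ = _ ` ?P")
  proof (intro equalityI subsetI)
    fix m assume "m \<in> independent_tuples (Suc k) S"
    then show "m \<in> (\<lambda>(l, x). x # l) ` ?P"
      by (cases m) (auto simp: independent_tuples_def independent_insert image_iff)
  next
    fix m assume "m \<in> (\<lambda>(l, x). x # l) ` ?P"
    then show "m \<in> independent_tuples (Suc k) S"
      by (auto simp: independent_tuples_def independent_insertI intro: span_base)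
  qed
  have "card (S - span (set l)) = CARD('a) ^ dim S - CARD('a) ^ k"
    if "l \<in> independent_tuples k S" for l
  proof -
    have l: "independent (set l)" "set l \<subseteq> S" "card (set l) = k"
      using that by (auto simp: independent_tuples_def distinct_card)
    have "span (set l) \<subseteq> S" using l S by (simp add: span_minimal)
    then show ?thesis
      using card_span_independent[OF fin _ l(1)] l card_subspace[OF fin S]
      by (simp add: card_Diff_subset)
  qed
  then have "card ?P = (\<Prod>j<Suc k. CARD('a) ^ dim S - CARD('a) ^ j)"
    using Suc.IH card_subspace(1)[OF fin S] by (subst card_SigmaI) simp_all
  moreover have "finite ?P" using Suc.IH card_subspace(1)[OF fin S] by (intro finite_SigmaI) auto
  moreover have "inj_on (\<lambda>(l, x). x # l) ?P" by (auto simp: inj_on_def)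
  ultimately show ?case
    unfolding eq by (simp only: card_image finite_imageI simp_thms)
qed

lemma finite_subspaces:
  assumes "finite (UNIV :: 'a set)"
  shows "finite {S. subspace S}"
  by (rule finite_subset[OF subset_UNIV])
    (simp only: Finite_Set.finite_set card_subspace(1)[OF assms subspace_UNIV])

text \<open>Each independent tuple is a basis of exactly one subspace, its span.\<close>

lemma card_subspaces_mult:
  assumes fin: "finite (UNIV :: 'a set)"
  shows "card {S. subspace S \<and> dim S = k} * (\<Prod>j<k. CARD('a) ^ k - CARD('a) ^ j)
    = (\<Prod>j<k. CARD('a) ^ dim UNIV - CARD('a) ^ j)"
proof -
  let ?X = "{S. subspace S \<and> dim S = k}"
  have X: "finite ?X" by (rule finite_subset[OF _ finite_subspaces[OF fin]]) auto
  have span: "span (set l) = S" if "S \<in> ?X" "l \<in> independent_tuples k S" for S l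
  proof (rule subspace_dim_equal)
    show "dim S \<le> dim (span (set l))"
      using that by (simp add: independent_tuples_def distinct_card dim_eq_card_independent)
  qed (use that in \<open>auto simp: independent_tuples_def span_minimal\<close>)
  have eq: "independent_tuples k UNIV = (\<Union>S\<in>?X. independent_tuples k S)"
  proof (intro equalityI subsetI)
    fix l assume l: "l \<in> independent_tuples k UNIV"
    then have "span (set l) \<in> ?X" "l \<in> independent_tuples k (span (set l))"
      by (auto simp: independent_tuples_def distinct_card dim_eq_card_independent span_superset)
    then show "l \<in> (\<Union>S\<in>?X. independent_tuples k S)" by blast
  qed (auto simp: independent_tuples_def)
  have "card (independent_tuples k UNIV) = (\<Sum>S\<in>?X. card (independent_tuples k S))"
    unfolding eq
  proof (rule card_UN_disjoint[OF X])
    show "\<forall>S\<in>?X. finite (independent_tuples k S)" using card_independent_tuples[OF fin] by simp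
    show "\<forall>S\<in>?X. \<forall>T\<in>?X. S \<noteq> T \<longrightarrow> independent_tuples k S \<inter> independent_tuples k T = {}"
      using span by blast
  qed
  also have "\<dots> = (\<Sum>S\<in>?X. \<Prod>j<k. CARD('a) ^ k - CARD('a) ^ j)"
    using card_independent_tuples[OF fin] by (intro sum.cong) auto
  finally show ?thesis using card_independent_tuples[OF fin subspace_UNIV, of k] by simp
qed

end

section \<open>Gaussian binomial coefficients\<close>

lemma q_fact_pos: "q > 1 \<Longrightarrow> q_fact q n > 0"
  unfolding q_fact_def q_int_def by (intro prod_pos divide_pos_pos) (auto simp: one_less_power)

lemma q_fact_Suc: "q_fact q (Suc n) = q_int q (Suc n) * q_fact q n"
  by (simp add: q_fact_def)

text \<open>Each factor \<open>q ^ n - q ^ j\<close> is \<open>q ^ j * (q - 1)\<close> times the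
  q-integer of \<open>n - j\<close>, and these q-integers multiply to a quotient of q-factorials,
  stated here without division. The product on the right does not depend on \<open>n\<close>, so it
  cancels when two values of \<open>n\<close> are compared.\<close>

lemma prod_power_diff_eq_q_fact:
  assumes "q > 1" "k \<le> n"
  shows "real (\<Prod>j<k. q ^ n - q ^ j) * q_fact q (n - k)
    = (\<Prod>j<k. real q ^ j * (real q - 1)) * q_fact q n"
  using assms(2)
proof (induction k)
  case 0
  then show ?case by simp
next
  case (Suc k)
  have n: "n - k = Suc (n - Suc k)" using Suc.prems by simp
  have "real (q ^ n - q ^ k) = real q ^ k * (real q - 1) * q_int q (n - k)"
  proof -
    have "q ^ k \<le> q ^ n" using assms(1) Suc.prems by (intro power_increasing) auto
    then have "real (q ^ n - q ^ k) = real q ^ n - real q ^ k" by (simp add: of_nat_diff)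
    also have "real q ^ n = real q ^ k * real q ^ (n - k)"
      using Suc.prems by (simp flip: power_add)
    finally have "real (q ^ n - q ^ k) = real q ^ k * (real q ^ (n - k) - 1)"
      by (simp add: algebra_simps)
    then show ?thesis using assms(1) by (simp add: q_int_def)
  qed
  then have "real (\<Prod>j<Suc k. q ^ n - q ^ j) * q_fact q (n - Suc k)
    = (real q ^ k * (real q - 1)) * (real (\<Prod>j<k. q ^ n - q ^ j) * q_fact q (n - k))"
    unfolding n q_fact_Suc by simp
  also have "\<dots> = (\<Prod>j<Suc k. real q ^ j * (real q - 1)) * q_fact q n"
    using Suc.prems by (subst Suc.IH) simp_all
  finally show ?case .
qed

text \<open>Both products in \<open>card_subspaces_mult\<close> are rewritten in q-factorials, one
  with \<open>n = dim UNIV\<close> and one with \<open>n = k\<close>; the common positive factor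
  \<open>?p\<close> then cancels.\<close>

lemma (in finite_dimensional_vector_space) card_subspaces_eq_q_binomial:
  assumes fin: "finite (UNIV :: 'a set)" and k: "k \<le> dim UNIV"
  shows "real (card {S. subspace S \<and> dim S = k}) = q_binomial CARD('a) (dim UNIV) k"
proof -
  let ?q = "CARD('a)" and ?N = "dim UNIV" and ?c = "real (card {S. subspace S \<and> dim S = k})"
  have q: "?q > 1"
    using card_mono[OF fin, of "{0, 1}"] by simp
  let ?p = "\<Prod>j<k. real ?q ^ j * (real ?q - 1)"
  have p: "?p > 0" using q by (intro prod_pos) auto
  have "?p * q_fact ?q ?N = real (\<Prod>j<k. ?q ^ ?N - ?q ^ j) * q_fact ?q (?N - k)"
    by (simp only: prod_power_diff_eq_q_fact[OF q k])
  \<comment> \<open>The factor \<open>q_fact ?q (k - k)\<close>, equal to 1, is inserted so that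
    \<open>prod_power_diff_eq_q_fact\<close> applies with \<open>n = k\<close>.\<close>
  also have "\<dots> = ?c * (real (\<Prod>j<k. ?q ^ k - ?q ^ j) * q_fact ?q (k - k)) * q_fact ?q (?N - k)"
    unfolding card_subspaces_mult[OF fin, of k, symmetric] of_nat_mult by (simp add: q_fact_def)
  also have "\<dots> = ?p * (?c * q_fact ?q k * q_fact ?q (?N - k))"
    unfolding prod_power_diff_eq_q_fact[OF q order_refl] by (simp only: mult_ac)
  finally have "q_fact ?q ?N = ?c * q_fact ?q k * q_fact ?q (?N - k)"
    using p by (subst (asm) mult_left_cancel) (rule less_imp_neq[symmetric])
  then show ?thesis
    using q_fact_pos[OF q, of k] q_fact_pos[OF q, of "?N - k"] by (simp add: q_binomial_def)
qed

section \<open>The spectra of the four matrices\<close>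

text \<open>Uniqueness of inverses: \<open>A_star_inv\<close> is a left inverse of
  \<open>A_star\<close>, and the diagonal matrix of reciprocal entries is a right inverse.\<close>

lemma A_star_inv_eq_mat_diag:
  fixes scale :: "'f::{field,finite} \<Rightarrow> 'v::ab_group_add \<Rightarrow> 'v"
  assumes "distinct xs"
  shows "A_star_inv scale xs
    = mat_diag (length xs) (\<lambda>i. of_nat CARD('f) ^ vector_space.dim scale (xs ! i))"
proof -
  let ?n = "length xs"
  let ?d = "\<lambda>i. of_nat CARD('f) ^ vector_space.dim scale (xs ! i) :: complex"
  have A: "A_star scale xs = mat_diag ?n (\<lambda>i. inverse (?d i))"
    using assms unfolding A_star_def indexed_mat_def mat_diag_def
    by (intro eq_matI) (auto simp: nth_eq_iff_index_eq)
  have "A_star scale xs * mat_diag ?n ?d = 1\<^sub>m ?n"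
    unfolding A by (simp add: mat_diag_diag flip: mat_diag_one)
  then have "A_star_inv scale xs = A_star_inv scale xs * (A_star scale xs * mat_diag ?n ?d)"
    using A_star_inv(1)[OF assms, of scale] by simp
  also have "\<dots> = A_star_inv scale xs * A_star scale xs * mat_diag ?n ?d"
    by (rule assoc_mult_mat[symmetric, of _ ?n ?n _ ?n _ ?n])
      (simp_all add: A_star_inv(1)[OF assms] A)
  also have "\<dots> = mat_diag ?n ?d"
    unfolding A_star_inv(3)[OF assms] by (rule left_mult_one_mat[OF mat_diag_dim])
  finally show ?thesis .
qed

text \<open>The common criterion for all four matrices. The grading \<open>f\<close> is left open,
  to be taken as dimension for the matrices built from \<open>R\<close> and as codimension for those
  built from \<open>L\<close>.\<close>

lemma spectrum_of_graded:
  fixes scale :: "'f::{field,finite} \<Rightarrow> 'v::ab_group_add \<Rightarrow> 'v" and f :: "nat \<Rightarrow> nat"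
  assumes fdvs: "finite_dimensional_vector_space scale Basis"
    and N: "vector_space.dim scale UNIV = N"
    and xs: "distinct xs" "set xs = subspaces scale"
    and A: "A \<in> carrier_mat (length xs) (length xs)"
    and diag: "\<And>i. i < length xs \<Longrightarrow>
      A $$ (i, i) = of_nat CARD('f) ^ vector_space.dim scale (xs ! i) / (of_nat CARD('f) - 1)"
    and tri: "\<And>i j. i < length xs \<Longrightarrow> j < length xs \<Longrightarrow> i \<noteq> j \<Longrightarrow> A $$ (i, j) \<noteq> 0 \<Longrightarrow> f j < f i"
    and f: "\<And>i j. i < length xs \<Longrightarrow> j < length xs \<Longrightarrow> f j < f i \<Longrightarrow>
      vector_space.dim scale (xs ! i) \<noteq> vector_space.dim scale (xs ! j)"
  shows "diagonalizable A
    \<and> {\<theta>. eigenvalue A \<theta>} = {of_nat CARD('f) ^ i / (of_nat CARD('f) - 1) | i. i \<le> N}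
    \<and> (\<forall>i \<le> N. real (eigenspace_dim A (of_nat CARD('f) ^ i / (of_nat CARD('f) - 1)))
        = q_binomial CARD('f) N i)"
proof -
  interpret finite_dimensional_vector_space scale Basis by (fact fdvs)
  let ?q = "CARD('f)" and ?n = "length xs"
  define ev :: "nat \<Rightarrow> complex" where "ev k = of_nat ?q ^ k / (of_nat ?q - 1)" for k
  have fin: "finite (UNIV :: 'f set)" by simp
  have q: "?q > 1" using card_mono[OF fin, of "{0, 1}"] by simp
  have ev_inj: "ev k = ev l \<longleftrightarrow> k = l" for k l
  proof -
    have "ev k = ev l \<longleftrightarrow> (of_nat (?q ^ k) :: complex) = of_nat (?q ^ l)"
      using q by (simp add: ev_def)
    also have "\<dots> \<longleftrightarrow> k = l" using q by (simp only: of_nat_eq_iff power_inject_exp)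
    finally show ?thesis .
  qed
  define d where "d i = dim (xs ! i)" for i
  have "similar_mat A (mat_diag ?n (\<lambda>i. A $$ (i, i)))"
    using A tri
  proof (rule similar_mat_diag_of_graded)
    show "A $$ (i, i) \<noteq> A $$ (j, j)" if "i < ?n" "j < ?n" "f j < f i" for i j
      using f[OF that] that by (simp add: diag ev_inj flip: ev_def)
  qed
  also have "mat_diag ?n (\<lambda>i. A $$ (i, i)) = mat_diag ?n (\<lambda>i. ev (d i))"
    by (rule eq_matI) (auto simp: mat_diag_def diag ev_def d_def)
  finally have sim: "similar_mat A (mat_diag ?n (\<lambda>i. ev (d i)))" .
  have count: "real (card {i. i < ?n \<and> d i = k}) = q_binomial ?q N k" if "k \<le> N" for k
  proof -
    have "{S. subspace S \<and> dim S = k} = {S \<in> set xs. dim S = k}"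
      using xs by (auto simp: subspaces_def)
    then have "bij_betw (\<lambda>i. xs ! i) {i. i < ?n \<and> d i = k} {S. subspace S \<and> dim S = k}"
      using xs(1) by (auto simp: bij_betw_def inj_on_def nth_eq_iff_index_eq d_def in_set_conv_nth)
    then have "card {i. i < ?n \<and> d i = k} = card {S. subspace S \<and> dim S = k}"
      by (rule bij_betw_same_card)
    then show ?thesis
      using card_subspaces_eq_q_binomial[OF fin, of k] that by (simp only: N)
  qed
  have "diagonalizable A"
    unfolding diagonalizable_def using sim
    by (intro exI[of _ "mat_diag ?n (\<lambda>i. ev (d i))"]) (simp add: diagonal_mat_def mat_diag_def)
  moreover have "{\<theta>. eigenvalue A \<theta>} = {ev i | i. i \<le> N}"
  proof -
    have "d i \<le> N" for i using dim_subset[OF subset_UNIV] by (simp only: d_def flip: N)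
    \<comment> \<open>That every dimension up to \<open>N\<close> occurs follows from the count: the
      Gaussian binomial is positive.\<close>
    moreover have "\<exists>i<?n. d i = k" if "k \<le> N" for k
    proof -
      have "real (card {i. i < ?n \<and> d i = k}) > 0"
        unfolding count[OF that] q_binomial_def by (intro divide_pos_pos mult_pos_pos q_fact_pos q)
      then have "{i. i < ?n \<and> d i = k} \<noteq> {}" by (metis card.empty of_nat_0 less_irrefl)
      then show ?thesis by blast
    qed
    ultimately show ?thesis unfolding eigenvalue_similar_mat_diag[OF sim] by blast
  qed
  moreover have "real (eigenspace_dim A (ev k)) = q_binomial ?q N k" if "k \<le> N" for k
    using count[OF that] unfolding eigenspace_dim_similar_mat_diag[OF sim] ev_inj .
  ultimately show ?thesis unfolding ev_def by blast
qed

theorem lemma15p15: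
  fixes scale :: "'f::{field,finite} \<Rightarrow> 'v::ab_group_add \<Rightarrow> 'v"
    and Basis :: "'v set" and q N :: nat and \<phi> :: real and xs :: "'v set list"
  assumes "q = CARD('f)"
    and "finite_dimensional_vector_space scale Basis"
    and "vector_space.dim scale UNIV = N" and "N \<ge> 1"
    and "\<phi> > 0"
    and "distinct xs" and "set xs = subspaces scale"
  shows "\<forall>A \<in> {A_sup_minus scale xs, A_sup_plus scale xs,
                 A_sub_minus scale xs \<phi>, A_sub_plus scale xs \<phi>}.
           diagonalizable A
           \<and> {\<theta>. eigenvalue A \<theta>} = {of_nat q ^ i / (of_nat q - 1) | i. i \<le> N}
           \<and> (\<forall>i \<le> N. real (eigenspace_dim A (of_nat q ^ i / (of_nat q - 1))) = q_binomial q N i)"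
proof -
  interpret finite_dimensional_vector_space scale Basis by (fact assms(2))
  let ?n = "length xs" and ?d = "\<lambda>i. dim (xs ! i)"
  have le: "?d i \<le> N" for i
    using dim_subset[OF subset_UNIV] by (simp only: flip: assms(3))
  let ?P = "\<lambda>A. diagonalizable A
    \<and> {\<theta>. eigenvalue A \<theta>} = {of_nat q ^ i / (of_nat q - 1) | i. i \<le> N}
    \<and> (\<forall>i \<le> N. real (eigenspace_dim A (of_nat q ^ i / (of_nat q - 1))) = q_binomial q N i)"
  note spectrum = spectrum_of_graded[OF assms(2,3,6,7), folded assms(1)]
  note defs = A_sup_minus_def A_sup_plus_def A_sub_minus_def A_sub_plus_def R_mat_def L_mat_def
    indexed_mat_def A_star_inv_eq_mat_diag[OF assms(6)]
  \<comment> \<open>Multiplying \<open>L\<close> by the diagonal inverse of \<open>A_star\<close> on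
    the left only rescales its rows, so no new nonzero positions arise.\<close>
  have DL: "mat_diag ?n g * mat ?n ?n h = mat ?n ?n (\<lambda>(i, j). g i * h (i, j))"
    for g :: "nat \<Rightarrow> complex" and h
    by (subst mat_diag_mult_left) (auto intro!: eq_matI)
  have diag: "dim_row (mat_diag ?n g) = ?n" "dim_col (mat_diag ?n g) = ?n"
    "i < ?n \<Longrightarrow> j < ?n \<Longrightarrow> mat_diag ?n g $$ (i, j) = (if i = j then g j else 0)"
    for g :: "nat \<Rightarrow> complex" and i j
    by (simp_all add: mat_diag_def)
  have up: "?d j < ?d i" if "covers scale (xs ! i) (xs ! j)" for i j
    using that by (simp add: covers_def)
  \<comment> \<open>\<open>L\<close> is nonzero where the column subspace covers the row subspace,
    so the grade must be codimension. The bound \<open>le\<close> keeps the truncated subtraction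
    strictly decreasing.\<close>
  have down: "N - ?d j < N - ?d i" if "covers scale (xs ! j) (xs ! i)" for i j
    using up[OF that] le[of j] by simp
  \<comment> \<open>\<open>R\<close> and \<open>L\<close> thus have zero diagonal, and all four
    matrices share the diagonal of the inverse of \<open>A_star\<close> divided by
    \<open>q - 1\<close>.\<close>
  have irrefl: "\<not> covers scale y y" for y by (simp add: covers_def)
  have "?P (A_sup_minus scale xs)"
    by (rule spectrum[where f = "\<lambda>i. N - ?d i"])
      (auto simp: defs DL diag irrefl assms(1) field_simps intro: down split: if_splits)
  moreover have "?P (A_sup_plus scale xs)"
    by (rule spectrum[where f = ?d])
      (auto simp: defs DL diag irrefl assms(1) field_simps intro: up split: if_splits)
  moreover have "?P (A_sub_minus scale xs \<phi>)"
    by (rule spectrum[where f = "\<lambda>i. N - ?d i"])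
      (auto simp: defs DL diag irrefl assms(1) field_simps intro: down split: if_splits)
  moreover have "?P (A_sub_plus scale xs \<phi>)"
    by (rule spectrum[where f = ?d])
      (auto simp: defs DL diag irrefl assms(1) field_simps intro: up split: if_splits)
  ultimately show ?thesis by blast
qed

end
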